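(* Let $-1<\alpha<\infty$. Then: (i) $\mathbb{A}^2_\alpha$ strictly increases as $\alpha$ increases, i.e. $-1<\alpha_1<\alpha_2<\infty$ implies $\mathbb{A}^2_{\alpha_1}\subsetneqq\mathbb{A}^2_{\alpha_2}$. (ii) $H^2(\mathbf{D})\subsetneqq\bigcap_{\alpha>-1}\mathbb{A}^2_\alpha$. (iii) $\bigcup_{-1<\gamma<\alpha}\mathbb{A}^2_\gamma\subset\mathbb{A}^2_\alpha\subsetneqq\bigcap_{\beta>\alpha}\mathbb{A}^2_\beta$. (iv) For $-1<\alpha<\beta<\infty$, the sets $P(\mathbf{D})$, $H^2(\mathbf{D})$ and $\mathbb{A}^2_\alpha$ are all dense in $\mathbb{A}^2_\beta$ (in the norm of $\mathbb{A}^2_\beta$).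
   Context: $\mathbf{D}$ is the open unit disc. For $\alpha>-1$, $\mathbb{A}^2_\alpha$ is the Hilbert space of holomorphic functions $f$ on $\mathbf{D}$ with $\|f\|^2_{\mathbb{A}^2_\alpha}=\int_{\mathbf{D}}|f|^2\,dA_\alpha<\infty$, where $dA_\alpha(z)=(1+\alpha)(1-|z|^2)^\alpha dA(z)$ and $dA=dx\,dy/\pi$. $H^2(\mathbf{D})$ is the Hardy space of holomorphic $f(z)=\sum_{k\ge0}a_kz^k$ on $\mathbf{D}$ with $\sum_{k\ge 0}|a_k|^2<\infty$. $P(\mathbf{D})$ is the set of (holomorphic) polynomials in $z$, regarded as functions on $\mathbf{D}$. *)

theory Defs
  imports "HOL-Analysis.Analysis" "HOL-Computational_Algebra.Polynomial"
begin

abbreviation unit_disc :: "complex set" where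
  "unit_disc \<equiv> ball 0 1"

(* A function on the disc is encoded as a total function that takes the fixed value
   "undefined" off the disc, so that HOL equality is equality of functions on the disc. *)
definition disc_holomorphic :: "(complex \<Rightarrow> complex) set" where
  "disc_holomorphic = {f \<in> extensional unit_disc. f holomorphic_on unit_disc}"

(* dA = dx dy / pi on the disc, as a measure on the complex plane with no mass off the disc. *)
definition disc_area :: "complex measure" where
  "disc_area = density lborel (\<lambda>z. ennreal (indicator unit_disc z / pi))"

definition weighted_disc_area :: "real \<Rightarrow> complex measure" where
  "weighted_disc_area \<alpha> =
     density disc_area (\<lambda>z. ennreal ((1 + \<alpha>) * (1 - (norm z)\<^sup>2) powr \<alpha>))"

definition bergman_sqnorm :: "real \<Rightarrow> (complex \<Rightarrow> complex) \<Rightarrow> ennreal" where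
  "bergman_sqnorm \<alpha> f = (\<integral>\<^sup>+ z. ennreal ((norm (f z))\<^sup>2) \<partial>weighted_disc_area \<alpha>)"

definition bergman_norm :: "real \<Rightarrow> (complex \<Rightarrow> complex) \<Rightarrow> real" where
  "bergman_norm \<alpha> f = sqrt (enn2real (bergman_sqnorm \<alpha> f))"

(* Meaningful for \<alpha> > -1 only. *)
definition bergman :: "real \<Rightarrow> (complex \<Rightarrow> complex) set" where
  "bergman \<alpha> = {f \<in> disc_holomorphic. bergman_sqnorm \<alpha> f < \<infinity>}"

definition hardy2 :: "(complex \<Rightarrow> complex) set" where
  "hardy2 = {f \<in> disc_holomorphic. \<exists>a :: nat \<Rightarrow> complex.
     (\<forall>z\<in>unit_disc. (\<lambda>k. a k * z ^ k) sums f z) \<and> summable (\<lambda>k. (norm (a k))\<^sup>2)}"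

definition disc_polynomials :: "(complex \<Rightarrow> complex) set" where
  "disc_polynomials = range (\<lambda>p :: complex poly. restrict (poly p) unit_disc)"

(* The difference f - g need not be "undefined" off the disc; the norm does not see its
   values there. *)
definition dense_in_bergman :: "real \<Rightarrow> (complex \<Rightarrow> complex) set \<Rightarrow> bool" where
  "dense_in_bergman \<beta> S \<longleftrightarrow> S \<subseteq> bergman \<beta> \<and>
     (\<forall>f\<in>bergman \<beta>. \<forall>\<epsilon>>0. \<exists>g\<in>S. bergman_norm \<beta> (\<lambda>z. f z - g z) < \<epsilon>)"

end

(* For f(z) = sum a_k z^k on the disc, the averages of |f|^2 over the N-th roots of unity times z
   tend to M(|z|^2) with M(t) = sum |a_k|^2 t^k. As dA_alpha is rotation invariant, Fatou's lemma
   (applied to these averages for one inequality, to the partial sums for the other) gives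
   ||f||^2 = integral of M(|z|^2) dA_alpha = sum |a_k|^2 (integral of |z|^(2k) dA_alpha).
   Polynomials are dense because the tails of this convergent series vanish. Moreover 1 - |z|^2 is
   uniformly distributed on (0,1) under dA, so membership of f only depends on the integral of
   M(1 - u) u^alpha over (0,1). Choosing M(t) = (1 - t)^(-1-alpha) produces a function that lies in
   A^2_beta exactly for beta > alpha, and M(t) = -ln (1 - t) one that lies in every A^2_gamma but
   not in H^2. *)
theory Submission
  imports Defs "HOL-Complex_Analysis.Cauchy_Integral_Formula"
begin

unbundle no fps_syntax

section \<open>Rotation invariance of planar Lebesgue measure\<close>

text \<open>Invariance of volume under orthogonal maps is used in \<open>real ^ 2\<close>, so the
  complex plane is identified with that space by a linear isometry.\<close>

definition complex_of_vec :: "real ^ 2 \<Rightarrow> complex" where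
  "complex_of_vec v = Complex (v $ 1) (v $ 2)"

definition vec_of_complex :: "complex \<Rightarrow> real ^ 2" where
  "vec_of_complex z = vector [Re z, Im z]"

lemma complex_of_vec_of_complex [simp]: "complex_of_vec (vec_of_complex z) = z"
  by (simp add: complex_of_vec_def vec_of_complex_def)

lemma vec_of_complex_of_vec [simp]: "vec_of_complex (complex_of_vec v) = v"
  by (simp add: complex_of_vec_def vec_of_complex_def vec_eq_iff forall_2)

lemma linear_complex_of_vec: "linear complex_of_vec"
  by (rule linearI) (simp_all add: complex_of_vec_def complex_eq_iff)

lemma linear_vec_of_complex: "linear vec_of_complex"
  by (rule linearI) (simp_all add: vec_of_complex_def vec_eq_iff forall_2)

lemma norm_complex_of_vec [simp]: "norm (complex_of_vec v) = norm v"
  by (simp add: complex_of_vec_def norm_vec_def L2_set_def UNIV_2 cmod_def)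

lemma norm_vec_of_complex [simp]: "norm (vec_of_complex z) = norm z"
  by (metis complex_of_vec_of_complex norm_complex_of_vec)

lemma complex_of_vec_measurable [measurable]: "complex_of_vec \<in> borel_measurable borel"
  by (intro borel_measurable_continuous_onI linear_continuous_on
        linear_conv_bounded_linear[THEN iffD1] linear_complex_of_vec)

text \<open>Lebesgue measure is determined by its values on boxes, and the identification matches
  boxes with boxes of the same side lengths.\<close>

lemma lborel_complex_eq_distr_vec: "lborel = distr lborel borel complex_of_vec"
proof (rule lborel_eqI)
  fix l u :: complex
  assume le: "\<And>b. b \<in> Basis \<Longrightarrow> l \<bullet> b \<le> u \<bullet> b"
  then have le': "Re l \<le> Re u" "Im l \<le> Im u"
    using le[of 1] le[of \<i>] by (simp_all add: Basis_complex_def)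
  have le'': "\<forall>i. vec_of_complex l $ i \<le> vec_of_complex u $ i"
    using le' by (simp add: forall_2 vec_of_complex_def)
  have "complex_of_vec -` box l u = box (vec_of_complex l) (vec_of_complex u)"
    by (auto simp: mem_box_cart box_Complex_eq complex_of_vec_def vec_of_complex_def forall_2 in_box_complex_iff)
  then have "emeasure (distr lborel borel complex_of_vec) (box l u)
      = emeasure lborel (box (vec_of_complex l) (vec_of_complex u))"
    by (simp add: emeasure_distr)
  also have "\<dots> = (\<Prod>b\<in>Basis. (vec_of_complex u - vec_of_complex l) \<bullet> b)"
    using le'' by (intro emeasure_lborel_box) (auto simp: Basis_vec_def inner_axis)
  also have "(\<Prod>b\<in>Basis. (vec_of_complex u - vec_of_complex l) \<bullet> b) = (\<Prod>b\<in>Basis. (u - l) \<bullet> b)"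
    by (simp add: Basis_vec_def Basis_complex_def UNIV_2 inner_axis vec_of_complex_def axis_eq_axis)
  finally show "emeasure (distr lborel borel complex_of_vec) (box l u) = (\<Prod>b\<in>Basis. (u - l) \<bullet> b)" .
qed simp

text \<open>Carried over to \<open>real ^ 2\<close>, multiplication by \<open>c\<close> becomes the
  orthogonal map \<open>R\<close>, which preserves volume. Again it is enough to compare the two
  measures on boxes.\<close>

lemma distr_lborel_mult_unit_complex:
  fixes c :: complex
  assumes c: "norm c = 1"
  shows "distr lborel borel (\<lambda>z. c * z) = lborel"
proof (rule lborel_eqI[symmetric])
  fix l u :: complex
  assume le: "\<And>b. b \<in> Basis \<Longrightarrow> l \<bullet> b \<le> u \<bullet> b"
  define B where "B = (\<lambda>z. c * z) -` box l u"
  define R where "R v = vec_of_complex (c * complex_of_vec v)" for v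
  have [simp]: "c \<noteq> 0" using c by auto
  have emB: "emeasure lborel A = emeasure lborel (complex_of_vec -` A)" if "A \<in> sets borel" for A
    using that by (subst lborel_complex_eq_distr_vec) (simp add: emeasure_distr)
  have R: "orthogonal_transformation R"
    unfolding orthogonal_transformation
  proof (intro conjI allI)
    show "linear R"
      unfolding R_def using linear_complex_of_vec linear_vec_of_complex
      by (intro linearI) (simp_all add: linear_add linear_scale distrib_left)
  qed (simp add: R_def c norm_mult)
  have Bm: "B \<in> sets borel"
    unfolding B_def by (rule measurable_sets_borel[where M=borel]) auto
  have img: "R ` (complex_of_vec -` B) = complex_of_vec -` box l u"
  proof safe
    fix v assume "complex_of_vec v \<in> box l u"
    then have "vec_of_complex (complex_of_vec v / c) \<in> complex_of_vec -` B"
      "v = R (vec_of_complex (complex_of_vec v / c))"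
      by (auto simp: B_def R_def)
    then show "v \<in> R ` (complex_of_vec -` B)" by blast
  qed (auto simp: R_def B_def)
  \<comment> \<open>Boundedness gives finite volume, as needed to pass between
    \<open>emeasure\<close> and the real-valued \<open>measure\<close> of
    \<open>measure_orthogonal_image\<close>.\<close>
  have bd: "bounded (complex_of_vec -` B)"
  proof -
    obtain K where K: "\<And>w. w \<in> box l u \<Longrightarrow> norm w \<le> K"
      using bounded_box[of l u] by (auto simp: bounded_iff)
    show ?thesis
      unfolding bounded_iff
    proof (intro exI[of _ K] ballI)
      fix v assume "v \<in> complex_of_vec -` B"
      then have "norm (c * complex_of_vec v) \<le> K" by (intro K) (auto simp: B_def)
      then show "norm v \<le> K" by (simp add: norm_mult c)
    qed
  qed
  have mB: "complex_of_vec -` B \<in> sets borel"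
    by (rule measurable_sets_borel[where M=borel]) (use Bm in auto)
  have lm: "complex_of_vec -` B \<in> lmeasurable"
    using bd mB by (intro bounded_set_imp_lmeasurable) auto
  have mbox: "complex_of_vec -` box l u \<in> sets borel"
    by (rule measurable_sets_borel[where M=borel]) auto
  have "emeasure (distr lborel borel (\<lambda>z. c * z)) (box l u) = emeasure lborel B"
    by (simp add: emeasure_distr B_def)
  also have "\<dots> = emeasure lborel (complex_of_vec -` B)"
    by (rule emB[OF Bm])
  also have "\<dots> = emeasure lebesgue (complex_of_vec -` B)"
    using mB by simp
  also have "\<dots> = measure lebesgue (R ` (complex_of_vec -` B))"
    using measure_orthogonal_image[OF R lm] emeasure_eq_measure2[OF lm] by simp
  also have "\<dots> = emeasure lebesgue (R ` (complex_of_vec -` B))"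
    using measurable_orthogonal_image[OF R lm] by (simp add: emeasure_eq_measure2)
  also have "\<dots> = emeasure lborel (complex_of_vec -` box l u)"
    using mbox by (simp add: img)
  also have "\<dots> = emeasure lborel (box l u)" by (rule emB[symmetric]) simp
  finally show "emeasure (distr lborel borel (\<lambda>z. c * z)) (box l u) = (\<Prod>b\<in>Basis. (u - l) \<bullet> b)"
    using le by simp
qed simp

section \<open>The weighted area measures\<close>

lemma unit_disc_density_measurable [measurable]:
  "(\<lambda>z. ennreal (indicator unit_disc z / pi)) \<in> borel_measurable borel"
  by (intro measurable_compose[OF _ measurable_ennreal] borel_measurable_divide
      borel_measurable_indicator) auto

lemma weight_measurable [measurable]:
  "(\<lambda>z :: complex. ennreal ((1 + \<alpha>) * (1 - (norm z)\<^sup>2) powr \<alpha>)) \<in> borel_measurable borel"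
  by measurable

lemma sets_disc_area [simp, measurable_cong]: "sets disc_area = sets borel"
  by (simp add: disc_area_def)

lemma sets_weighted_disc_area [simp, measurable_cong]: "sets (weighted_disc_area \<alpha>) = sets borel"
  by (simp add: weighted_disc_area_def)

lemma space_weighted_disc_area [simp]: "space (weighted_disc_area \<alpha>) = UNIV"
  using sets_eq_imp_space_eq[OF sets_weighted_disc_area] by simp

lemma space_disc_area [simp]: "space disc_area = UNIV"
  using sets_eq_imp_space_eq[OF sets_disc_area] by simp

lemma nn_integral_disc_area:
  assumes "g \<in> borel_measurable borel"
  shows "(\<integral>\<^sup>+ z. g z \<partial>disc_area) = (\<integral>\<^sup>+ z. ennreal (indicator unit_disc z / pi) * g z \<partial>lborel)"
  unfolding disc_area_def
  by (rule nn_integral_density) (use assms unit_disc_density_measurable in auto)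

lemma nn_integral_weighted_disc_area:
  assumes [measurable]: "g \<in> borel_measurable borel"
  shows "(\<integral>\<^sup>+ z. g z \<partial>weighted_disc_area \<alpha>)
    = (\<integral>\<^sup>+ z. ennreal ((1 + \<alpha>) * (1 - (norm z)\<^sup>2) powr \<alpha>) * g z \<partial>disc_area)"
  unfolding weighted_disc_area_def by (rule nn_integral_density) measurable

lemma AE_disc_area: "AE z in disc_area. z \<in> unit_disc"
proof -
  have "0 < ennreal (indicator unit_disc z / pi) \<longrightarrow> z \<in> unit_disc" for z :: complex
    by (cases "z \<in> unit_disc") simp_all
  then have "AE z in lborel. 0 < ennreal (indicator unit_disc z / pi) \<longrightarrow> z \<in> unit_disc"
    by (intro AE_I2)
  then show ?thesis
    unfolding disc_area_def
    by (rule AE_density[THEN iffD2, rotated]) (use unit_disc_density_measurable in simp)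
qed

lemma AE_weighted_disc_area: "AE z in weighted_disc_area \<alpha>. z \<in> unit_disc"
proof -
  have "AE z in disc_area. 0 < ennreal ((1 + \<alpha>) * (1 - (norm z)\<^sup>2) powr \<alpha>) \<longrightarrow> z \<in> unit_disc"
    by (rule AE_mp[OF AE_disc_area AE_I2]) blast
  then show ?thesis
    unfolding weighted_disc_area_def
    by (rule AE_density[THEN iffD2, rotated]) measurable
qed

lemma bergman_sqnorm_cong:
  assumes "\<And>z. z \<in> unit_disc \<Longrightarrow> f z = g z"
  shows "bergman_sqnorm \<alpha> f = bergman_sqnorm \<alpha> g"
  unfolding bergman_sqnorm_def
  by (rule nn_integral_cong_AE, rule AE_mp[OF AE_weighted_disc_area]) (simp add: assms)

text \<open>The whole density with respect to \<open>lborel\<close> depends on \<open>norm z\<close>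
  only, so the rotation invariance of \<open>lborel\<close> carries over.\<close>

lemma nn_integral_weighted_disc_area_rotate:
  fixes c :: complex
  assumes c: "norm c = 1" and [measurable]: "g \<in> borel_measurable borel"
  shows "(\<integral>\<^sup>+ z. g (c * z) \<partial>weighted_disc_area \<alpha>) = (\<integral>\<^sup>+ z. g z \<partial>weighted_disc_area \<alpha>)"
proof -
  define h where "h z = ennreal (indicator unit_disc z / pi)
    * (ennreal ((1 + \<alpha>) * (1 - (norm z)\<^sup>2) powr \<alpha>) * g z)" for z :: complex
  have [measurable]: "h \<in> borel_measurable borel"
    unfolding h_def
    by (intro borel_measurable_times_ennreal unit_disc_density_measurable weight_measurable assms)
  have "(\<integral>\<^sup>+ z. g (c * z) \<partial>weighted_disc_area \<alpha>) = (\<integral>\<^sup>+ z. h (c * z) \<partial>lborel)"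
    by (subst nn_integral_weighted_disc_area, simp, subst nn_integral_disc_area)
      (auto simp: h_def norm_mult c indicator_def)
  also have "\<dots> = (\<integral>\<^sup>+ z. h z \<partial>distr lborel borel (\<lambda>z. c * z))"
    by (subst nn_integral_distr) auto
  also have "\<dots> = (\<integral>\<^sup>+ z. g z \<partial>weighted_disc_area \<alpha>)"
    unfolding distr_lborel_mult_unit_complex[OF c]
    unfolding h_def
    by (subst nn_integral_weighted_disc_area, simp, subst nn_integral_disc_area) auto
  finally show ?thesis .
qed

section \<open>Radial integrals over the disc\<close>

text \<open>Both measures are compared on the half-lines \<open>{x<..}\<close>. Inside the disc,
  \<open>1 - (norm z)\<^sup>2\<close> exceeds \<open>x\<close> exactly on a disc of squared radius
  \<open>s\<close>, whose normalised area is \<open>s\<close>; the two maxima in \<open>s\<close>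
  handle negative \<open>x\<close> and \<open>x\<close> beyond 1.\<close>

lemma distr_disc_area_one_minus_norm_sq:
  "distr disc_area borel (\<lambda>z. 1 - (norm z)\<^sup>2) = density lborel (indicator {0<..<1})"
proof (rule measure_eqI_lessThan)
  have eq: "emeasure (distr disc_area borel (\<lambda>z. 1 - (norm z)\<^sup>2)) {x<..} = ennreal (max 0 (1 - max 0 x))"
    for x :: real
  proof -
    define s where "s = max 0 (1 - max 0 x)"
    have key: "x < 1 - n \<and> n < 1 \<longleftrightarrow> n < max 0 (1 - max 0 x)" if "0 \<le> n" for n :: real
      using that by (auto simp: max_def)
    have A: "{z::complex. x < 1 - (norm z)\<^sup>2} \<inter> unit_disc = ball 0 (sqrt s)"
    proof (rule set_eqI)
      fix z :: complex
      have "z \<in> ball 0 (sqrt s) \<longleftrightarrow> (norm z)\<^sup>2 < s"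
        by (metis mem_ball_0 norm_ge_zero real_sqrt_abs abs_of_nonneg real_sqrt_less_iff)
      moreover have "z \<in> unit_disc \<longleftrightarrow> (norm z)\<^sup>2 < 1"
        by (simp add: abs_square_less_1)
      ultimately show "z \<in> {z. x < 1 - (norm z)\<^sup>2} \<inter> unit_disc \<longleftrightarrow> z \<in> ball 0 (sqrt s)"
        using key[of "(norm z)\<^sup>2"] by (simp add: s_def)
    qed
    have "emeasure (distr disc_area borel (\<lambda>z. 1 - (norm z)\<^sup>2)) {x<..}
        = emeasure disc_area {z. x < 1 - (norm z)\<^sup>2}"
      by (simp add: emeasure_distr vimage_def)
    also have "\<dots> = (\<integral>\<^sup>+ z. ennreal (indicator unit_disc z / pi) * indicator {z. x < 1 - (norm z)\<^sup>2} z \<partial>lborel)"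
      unfolding disc_area_def
      by (rule emeasure_density) (use unit_disc_density_measurable in auto)
    also have "\<dots> = (\<integral>\<^sup>+ z. ennreal (1 / pi) * indicator (ball 0 (sqrt s)) (z :: complex) \<partial>lborel)"
    proof (rule nn_integral_cong)
      fix z :: complex
      have "z \<in> ball 0 (sqrt s) \<longleftrightarrow> x < 1 - (norm z)\<^sup>2 \<and> z \<in> unit_disc"
        using A by blast
      then show "ennreal (indicator unit_disc z / pi) * indicator {z. x < 1 - (norm z)\<^sup>2} z
        = ennreal (1 / pi) * indicator (ball 0 (sqrt s)) z"
        by (auto simp: indicator_def)
    qed
    also have "\<dots> = ennreal (1 / pi) * emeasure lborel (ball 0 (sqrt s) :: complex set)"
      by (rule nn_integral_cmult_indicator) simp
    also have "\<dots> = ennreal (1 / pi) * ennreal (pi * s)"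
      by (subst emeasure_ball) (auto simp: unit_ball_vol_2 s_def)
    also have "\<dots> = ennreal s"
      by (simp add: s_def flip: ennreal_mult')
    finally show ?thesis by (simp add: s_def)
  qed
  show "emeasure (distr disc_area borel (\<lambda>z. 1 - (norm z)\<^sup>2)) {x<..} < \<infinity>" for x
    by (simp add: eq)
  show "emeasure (distr disc_area borel (\<lambda>z. 1 - (norm z)\<^sup>2)) {x<..}
    = emeasure (density lborel (indicator {0<..<1})) {x<..}" for x
  proof -
    have "emeasure (density lborel (indicator {0<..<1})) {x<..}
      = (\<integral>\<^sup>+ t. indicator {max 0 x<..<1} t \<partial>lborel)"
      by (subst emeasure_density, simp, simp, rule nn_integral_cong) (auto split: split_indicator)
    also have "\<dots> = emeasure lborel {max 0 x<..<1}"
      by (rule nn_integral_indicator) simp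
    also have "\<dots> = ennreal (max 0 (1 - max 0 x))"
      by (cases "max 0 x \<le> 1") (simp_all add: max_def)
    finally show ?thesis by (simp add: eq)
  qed
qed auto

lemma nn_integral_disc_area_radial:
  assumes [measurable]: "g \<in> borel_measurable borel"
  shows "(\<integral>\<^sup>+ z. g (1 - (norm z)\<^sup>2) \<partial>disc_area) = (\<integral>\<^sup>+ u. indicator {0<..<1} u * g u \<partial>lborel)"
proof -
  have "(\<integral>\<^sup>+ z. g (1 - (norm z)\<^sup>2) \<partial>disc_area)
      = (\<integral>\<^sup>+ u. g u \<partial>distr disc_area borel (\<lambda>z. 1 - (norm z)\<^sup>2))"
    by (subst nn_integral_distr) auto
  also have "\<dots> = (\<integral>\<^sup>+ u. indicator {0<..<1} u * g u \<partial>lborel)"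
    by (subst distr_disc_area_one_minus_norm_sq, subst nn_integral_density) auto
  finally show ?thesis .
qed

lemma nn_integral_powr_unit_interval:
  fixes p :: real
  assumes "p > -1"
  shows "(\<integral>\<^sup>+ u. indicator {0<..<1} u * ennreal (u powr p) \<partial>lborel) = ennreal (1 / (p + 1))"
proof -
  have "(\<integral>\<^sup>+ u. ennreal (u powr p) * indicator {0..1} u \<partial>lborel) = ennreal (1 / (p + 1))"
    using has_integral_powr_from_0[OF assms, of 1]
    by (intro nn_integral_has_integral_lebesgue') auto
  moreover have "(\<integral>\<^sup>+ u. indicator {0<..<1} u * ennreal (u powr p) \<partial>lborel)
    = (\<integral>\<^sup>+ u. ennreal (u powr p) * indicator {0..1} u \<partial>lborel)"
    by (rule nn_integral_cong_AE)
      (use AE_lborel_singleton[of "0::real"] AE_lborel_singleton[of "1::real"] in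
        \<open>eventually_elim, auto simp: indicator_def\<close>)
  ultimately show ?thesis by simp
qed

text \<open>The part of the integral over \<open>{exp (- real n)..1}\<close> already equals
  \<open>n\<close>, for every \<open>n\<close>.\<close>

lemma nn_integral_inverse_unit_interval:
  "(\<integral>\<^sup>+ u. indicator {0<..<1} u * ennreal (u powr -1) \<partial>lborel) = \<infinity>"
proof -
  have pos: "0 < u" if "exp (- real n) \<le> u" for u n
    using that by (rule less_le_trans[OF exp_gt_zero])
  have "ennreal (real n) \<le> (\<integral>\<^sup>+ u. indicator {0<..<1} u * ennreal (u powr -1) \<partial>lborel)" for n
  proof -
    have "(\<integral>\<^sup>+ u. ennreal (1 / u) * indicator {exp (- real n)..1} u \<partial>lborel) = ennreal (ln 1 - ln (exp (- real n)))"
      by (rule nn_integral_FTC_Icc)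
        (auto intro!: derivative_eq_intros dest: pos)
    then have "ennreal (real n) = (\<integral>\<^sup>+ u. ennreal (1 / u) * indicator {exp (- real n)..1} u \<partial>lborel)"
      by simp
    also have "\<dots> \<le> (\<integral>\<^sup>+ u. indicator {0<..<1} u * ennreal (u powr -1) \<partial>lborel)"
      by (rule nn_integral_mono_AE)
        (use AE_lborel_singleton[of "1::real"] in \<open>eventually_elim,
          auto simp: indicator_def powr_minus_divide dest: pos\<close>)
    finally show ?thesis .
  qed
  then show ?thesis
    by (metis ennreal_Ex_less_of_nat ennreal_of_nat_eq_real_of_nat infinity_ennreal_def leD top.not_eq_extremum)
qed

text \<open>The weight is itself a power of \<open>1 - (norm z)\<^sup>2\<close>, so the exponents
  add up before the radial substitution is made.\<close>

lemma nn_integral_weighted_disc_area_powr: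
  "(\<integral>\<^sup>+ z. ennreal ((1 - (norm z)\<^sup>2) powr q) \<partial>weighted_disc_area \<alpha>)
    = ennreal (1 + \<alpha>) * (\<integral>\<^sup>+ u. indicator {0<..<1} u * ennreal (u powr (\<alpha> + q)) \<partial>lborel)"
proof -
  have "(\<integral>\<^sup>+ z. ennreal ((1 - (norm z)\<^sup>2) powr q) \<partial>weighted_disc_area \<alpha>)
    = (\<integral>\<^sup>+ z. ennreal (1 + \<alpha>) * ennreal ((1 - (norm z)\<^sup>2) powr (\<alpha> + q)) \<partial>disc_area)"
  proof (subst nn_integral_weighted_disc_area, measurable, rule nn_integral_cong)
    fix z :: complex
    show "ennreal ((1 + \<alpha>) * (1 - (norm z)\<^sup>2) powr \<alpha>) * ennreal ((1 - (norm z)\<^sup>2) powr q)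
      = ennreal (1 + \<alpha>) * ennreal ((1 - (norm z)\<^sup>2) powr (\<alpha> + q))"
      by (simp only: powr_add ennreal_mult'' powr_ge_zero mult.assoc)
  qed
  also have "\<dots> = ennreal (1 + \<alpha>) * (\<integral>\<^sup>+ z. ennreal ((1 - (norm z)\<^sup>2) powr (\<alpha> + q)) \<partial>disc_area)"
    by (rule nn_integral_cmult) auto
  finally show ?thesis
    using nn_integral_disc_area_radial[of "\<lambda>u. ennreal (u powr (\<alpha> + q))"] by simp
qed

lemma emeasure_weighted_disc_area_UNIV:
  assumes "\<alpha> > -1"
  shows "emeasure (weighted_disc_area \<alpha>) UNIV = 1"
proof -
  have "emeasure (weighted_disc_area \<alpha>) UNIV = (\<integral>\<^sup>+ z. 1 \<partial>weighted_disc_area \<alpha>)"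
    by simp
  \<comment> \<open>\<open>0 powr 0\<close> is 0, so this holds almost everywhere only: the unit
    circle has to be excluded.\<close>
  also have "\<dots> = (\<integral>\<^sup>+ z. ennreal ((1 - (norm z)\<^sup>2) powr 0) \<partial>weighted_disc_area \<alpha>)"
  proof (rule nn_integral_cong_AE, rule AE_mp[OF AE_weighted_disc_area AE_I2], rule impI)
    fix z :: complex assume "z \<in> unit_disc"
    then have "(norm z)\<^sup>2 < 1" by (simp add: abs_square_less_1)
    then show "1 = ennreal ((1 - (norm z)\<^sup>2) powr 0)" by simp
  qed
  also have "\<dots> = ennreal ((1 + \<alpha>) * (1 / (\<alpha> + 1)))"
    using assms
    by (simp only: nn_integral_weighted_disc_area_powr add_0_right
        nn_integral_powr_unit_interval ennreal_mult')
  finally show ?thesis using assms by (simp add: add.commute)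
qed

section \<open>The Bergman norm in terms of Taylor coefficients\<close>

text \<open>This is a geometric sum whose ratio \<open>q\<close> is an N-th root of unity. Since
  \<open>cnj w\<close> is the inverse of \<open>w\<close>, the ratio is \<open>w\<close> to the
  power k - l, which is 1 only for \<open>k = l\<close> because both indices lie below
  \<open>N\<close>.\<close>

lemma sum_roots_of_unity_orthogonal:
  assumes "k < N" "l < N"
  shows "(\<Sum>j<N. cis (2 * pi * real j / real N) ^ k * cnj (cis (2 * pi * real j / real N)) ^ l)
    = (if k = l then of_nat N else 0)"
proof -
  define w where "w = cis (2 * pi / real N)"
  have N: "N > 0" using assms by simp
  have wj: "cis (2 * pi * real j / real N) = w ^ j" for j
    unfolding w_def Complex.DeMoivre by (rule arg_cong[of _ _ cis]) simp
  have wN: "w ^ N = 1"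
    unfolding wj[symmetric] using N by simp
  have cw: "w * cnj w = 1"
    by (simp add: w_def cis_cnj cis_mult)
  define q where "q = w ^ k * cnj w ^ l"
  have qj: "q ^ j = (w ^ j) ^ k * cnj (w ^ j) ^ l" for j
    unfolding q_def complex_cnj_power power_mult_distrib power_mult[symmetric]
    by (simp only: mult.commute)
  have "(\<Sum>j<N. cis (2 * pi * real j / real N) ^ k * cnj (cis (2 * pi * real j / real N)) ^ l) = (\<Sum>j<N. q ^ j)"
    by (simp only: wj qj)
  also have "\<dots> = (if k = l then of_nat N else 0)"
  proof (cases "k = l")
    case True
    then have "q = 1"
      by (simp add: q_def cw flip: power_mult_distrib)
    with True show ?thesis by simp
  next
    case False
    have "q \<noteq> 1"
    proof
      assume "q = 1"
      \<comment> \<open>Multiplying \<open>q = 1\<close> by \<open>w ^ l\<close> removes the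
        conjugates; distinct indices below \<open>N\<close> give distinct roots of unity.\<close>
      then have "w ^ l = (w * cnj w) ^ l * w ^ k"
        by (simp add: q_def power_mult_distrib mult_ac)
      then have "cis (2 * pi * real l / real N) = cis (2 * pi * real k / real N)"
        by (simp add: cw wj)
      with Complex.bij_betw_roots_unity[OF N] assms have "l = k"
        by (auto simp: bij_betw_def inj_on_def)
      with False show False by simp
    qed
    then show ?thesis
      using False wN geometric_sum[of q N] by (simp add: qj[of N])
  qed
  finally show ?thesis .
qed

text \<open>A finite substitute for the mean of the squared modulus over the circle through
  \<open>z\<close>, so that invariance under single rotations suffices and no polar coordinates are
  required.\<close>

definition roots_mean :: "nat \<Rightarrow> (complex \<Rightarrow> complex) \<Rightarrow> complex \<Rightarrow> real" where
  "roots_mean N f z = (\<Sum>j<N. (norm (f (cis (2 * pi * real j / real N) * z)))\<^sup>2) / real N"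

text \<open>Parseval's identity, exact for finitely many roots: after expanding the squares,
  orthogonality removes every cross term because all exponents are below \<open>N\<close>.\<close>

lemma roots_mean_polynomial:
  assumes "n \<le> N" "N > 0"
  shows "roots_mean N (\<lambda>z. \<Sum>k<n. a k * z ^ k) z = (\<Sum>k<n. (norm (a k))\<^sup>2 * ((norm z)\<^sup>2) ^ k)"
proof -
  define c where "c j = cis (2 * pi * real j / real N)" for j
  define X where "X k l = a k * cnj (a l) * z ^ k * cnj z ^ l" for k l
  have orth: "(\<Sum>j<N. c j ^ k * cnj (c j) ^ l) = (if k = l then of_nat N else 0)" if "k < n" "l < n" for k l
    unfolding c_def using sum_roots_of_unity_orthogonal[of k N l] that assms by simp
  have "complex_of_real (\<Sum>j<N. (norm (\<Sum>k<n. a k * (c j * z) ^ k))\<^sup>2)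
      = (\<Sum>j<N. (\<Sum>k<n. a k * (c j * z) ^ k) * cnj (\<Sum>k<n. a k * (c j * z) ^ k))"
    by (simp only: of_real_sum complex_norm_square)
  also have "\<dots> = (\<Sum>j<N. \<Sum>k<n. \<Sum>l<n. X k l * (c j ^ k * cnj (c j) ^ l))"
    by (simp add: sum_product X_def power_mult_distrib mult_ac)
  also have "\<dots> = (\<Sum>k<n. \<Sum>j<N. \<Sum>l<n. X k l * (c j ^ k * cnj (c j) ^ l))"
    by (rule sum.swap)
  also have "\<dots> = (\<Sum>k<n. \<Sum>l<n. \<Sum>j<N. X k l * (c j ^ k * cnj (c j) ^ l))"
    by (intro sum.cong refl sum.swap)
  also have "\<dots> = (\<Sum>k<n. \<Sum>l<n. if k = l then X k k * of_nat N else 0)"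
    by (intro sum.cong refl) (simp add: orth flip: sum_distrib_left)
  also have "\<dots> = (\<Sum>k<n. X k k * of_nat N)"
    by simp
  also have "\<dots> = (\<Sum>k<n. complex_of_real ((norm (a k))\<^sup>2 * ((norm z)\<^sup>2) ^ k * real N))"
  proof (intro sum.cong refl)
    fix k
    have "X k k = (a k * cnj (a k)) * (z * cnj z) ^ k"
      by (simp add: X_def power_mult_distrib)
    then show "X k k * of_nat N = complex_of_real ((norm (a k))\<^sup>2 * ((norm z)\<^sup>2) ^ k * real N)"
      by (simp flip: complex_norm_square)
  qed
  also have "\<dots> = complex_of_real ((\<Sum>k<n. (norm (a k))\<^sup>2 * ((norm z)\<^sup>2) ^ k) * real N)"
    by (simp add: sum_distrib_right)
  finally have "(\<Sum>j<N. (norm (\<Sum>k<n. a k * (c j * z) ^ k))\<^sup>2)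
      = (\<Sum>k<n. (norm (a k))\<^sup>2 * ((norm z)\<^sup>2) ^ k) * real N"
    by (simp only: of_real_eq_iff)
  then show ?thesis
    using assms by (simp add: roots_mean_def c_def)
qed

section \<open>Convergence of the circular means\<close>

lemma summable_norm_coeff_power:
  fixes a :: "nat \<Rightarrow> complex" and r :: real
  assumes sums: "\<And>z. z \<in> unit_disc \<Longrightarrow> (\<lambda>k. a k * z ^ k) sums f z" and r: "0 \<le> r" "r < 1"
  shows "summable (\<lambda>k. norm (a k) * r ^ k)"
proof -
  have "summable (\<lambda>k. norm (a k * complex_of_real r ^ k))"
  proof (rule powser_insidea)
    \<comment> \<open>Convergence at the midpoint between \<open>r\<close> and 1 forces absolute
      convergence at the smaller radius \<open>r\<close>.\<close>
    show "summable (\<lambda>k. a k * complex_of_real ((1 + r) / 2) ^ k)"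
      using r by (intro sums_summable[OF sums]) (simp del: of_real_add of_real_divide)
    show "norm (complex_of_real r) < norm (complex_of_real ((1 + r) / 2))"
      using r by (simp del: of_real_add of_real_divide)
  qed
  then show ?thesis
    using r by (simp add: norm_mult norm_power)
qed

text \<open>Each term is the square of a term \<open>A k\<close> of an absolutely convergent series.
  As \<open>A k\<close> is at most \<open>suminf A\<close>, this square is dominated by a multiple
  of \<open>A k\<close>.\<close>

lemma summable_norm_coeff_sq_power:
  fixes a :: "nat \<Rightarrow> complex" and t :: real
  assumes sums: "\<And>z. z \<in> unit_disc \<Longrightarrow> (\<lambda>k. a k * z ^ k) sums f z" and t: "0 \<le> t" "t < 1"
  shows "summable (\<lambda>k. (norm (a k))\<^sup>2 * t ^ k)"
proof -
  define A where "A k = norm (a k) * sqrt t ^ k" for k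
  have A: "summable A"
    unfolding A_def using t by (intro summable_norm_coeff_power[OF sums]) auto
  have "norm ((norm (a k))\<^sup>2 * t ^ k) \<le> suminf A * A k" for k
  proof -
    have "(norm (a k))\<^sup>2 * t ^ k = A k * A k"
      using t by (simp add: A_def power2_eq_square mult_ac flip: power_mult_distrib)
    moreover have "A k \<le> suminf A"
      using sum_le_suminf[OF A, of "{k}"] t by (simp add: A_def)
    ultimately show ?thesis
      using t by (simp add: A_def mult_right_mono)
  qed
  then show ?thesis
    by (intro summable_comparison_test[OF _ summable_mult[OF A]]) blast
qed

text \<open>For the partial sum with \<open>N\<close> terms, the mean over \<open>N\<close> roots is
  known exactly. Replacing \<open>f\<close> by this partial sum costs at most a multiple of
  \<open>tail N\<close>, uniformly on the circle through \<open>z\<close>.\<close>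

lemma roots_mean_tendsto:
  fixes a :: "nat \<Rightarrow> complex" and z :: complex
  assumes sums: "\<And>z. z \<in> unit_disc \<Longrightarrow> (\<lambda>k. a k * z ^ k) sums f z" and z: "z \<in> unit_disc"
  shows "(\<lambda>N. roots_mean N f z) \<longlonglongrightarrow> (\<Sum>k. (norm (a k))\<^sup>2 * ((norm z)\<^sup>2) ^ k)"
proof -
  define A where "A k = norm (a k) * norm z ^ k" for k
  define p where "p N w = (\<Sum>k<N. a k * w ^ k)" for N and w :: complex
  define tail where "tail N = suminf A - (\<Sum>k<N. A k)" for N
  have A: "summable A"
    unfolding A_def using z by (intro summable_norm_coeff_power[OF sums]) auto
  have A0: "0 \<le> A k" for k by (simp add: A_def)
  have M: "summable (\<lambda>k. (norm (a k))\<^sup>2 * ((norm z)\<^sup>2) ^ k)"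
    using z by (intro summable_norm_coeff_sq_power[OF sums]) (auto simp: abs_square_less_1)
  have near: "\<bar>(norm (f w))\<^sup>2 - (norm (p N w))\<^sup>2\<bar> \<le> 2 * suminf A * tail N" if w: "norm w = norm z" for w N
  proof -
    have nA: "norm (a k * w ^ k) = A k" for k
      by (simp add: A_def norm_mult norm_power w)
    have fw: "(\<lambda>k. a k * w ^ k) sums f w"
      using z w by (intro sums) simp
    have pw: "norm (p N w) \<le> suminf A"
    proof -
      have "norm (p N w) \<le> (\<Sum>k<N. A k)"
        unfolding p_def by (rule sum_norm_le) (simp add: nA)
      also have "\<dots> \<le> suminf A"
        by (rule sum_le_suminf[OF A]) (auto simp: A0)
      finally show ?thesis .
    qed
    have "f w - p N w = (\<Sum>k. a (k + N) * w ^ (k + N))"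
      using suminf_minus_initial_segment[OF sums_summable[OF fw], of N] sums_unique[OF fw]
      by (simp add: p_def)
    also have "norm \<dots> \<le> (\<Sum>k. A (k + N))"
      using summable_norm[of "\<lambda>k. a (k + N) * w ^ (k + N)"] summable_ignore_initial_segment[OF A, of N]
      by (simp add: nA)
    also have "\<dots> = tail N"
      unfolding tail_def by (rule suminf_minus_initial_segment[OF A])
    finally have diff: "norm (f w - p N w) \<le> tail N" .
    have fw': "norm (f w) \<le> suminf A"
      using summable_norm[of "\<lambda>k. a k * w ^ k"] A sums_unique[OF fw] by (simp add: nA)
    \<comment> \<open>A difference of squares: one factor is controlled by the tail, the other by
      twice \<open>suminf A\<close>.\<close>
    have "\<bar>(norm (f w))\<^sup>2 - (norm (p N w))\<^sup>2\<bar> = \<bar>norm (f w) - norm (p N w)\<bar> * (norm (f w) + norm (p N w))"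
      by (simp only: power2_eq_square square_diff_square_factored abs_mult abs_of_nonneg
          norm_ge_zero add_nonneg_nonneg mult.commute)
    also have "\<dots> \<le> tail N * (suminf A + suminf A)"
      using diff fw' pw order.trans[OF norm_ge_zero diff]
      by (intro mult_mono add_mono order.trans[OF norm_triangle_ineq3]) auto
    finally show ?thesis by (simp add: algebra_simps)
  qed
  have "\<bar>roots_mean N f z - (\<Sum>k<N. (norm (a k))\<^sup>2 * ((norm z)\<^sup>2) ^ k)\<bar> \<le> 2 * suminf A * tail N" if N: "N > 0" for N
  proof -
    define c where "c j = cis (2 * pi * real j / real N)" for j
    have "roots_mean N f z - (\<Sum>k<N. (norm (a k))\<^sup>2 * ((norm z)\<^sup>2) ^ k)
        = roots_mean N f z - roots_mean N (p N) z"
      \<comment> \<open>The number of roots equals the number of terms, the smallest number of roots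
        for which the polynomial formula applies.\<close>
      using roots_mean_polynomial[of N N a z] N by (simp add: p_def[abs_def])
    also have "\<dots> = (\<Sum>j<N. (norm (f (c j * z)))\<^sup>2 - (norm (p N (c j * z)))\<^sup>2) / real N"
      by (simp add: roots_mean_def c_def sum_subtractf diff_divide_distrib)
    also have "\<bar>\<dots>\<bar> \<le> (\<Sum>j<N. 2 * suminf A * tail N) / real N"
      using N unfolding abs_divide abs_of_nat
      by (intro divide_right_mono order.trans[OF sum_abs] sum_mono near)
        (simp_all add: c_def norm_mult)
    finally show ?thesis using N by simp
  qed
  then have "\<forall>\<^sub>F N in sequentially. norm (roots_mean N f z - (\<Sum>k<N. (norm (a k))\<^sup>2 * ((norm z)\<^sup>2) ^ k)) \<le> 2 * suminf A * tail N"
    by (intro eventually_mono[OF eventually_gt_at_top[of 0]]) simp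
  moreover have "(\<lambda>N. 2 * suminf A * tail N) \<longlonglongrightarrow> 2 * suminf A * (suminf A - suminf A)"
    unfolding tail_def by (intro tendsto_mult tendsto_const tendsto_diff summable_LIMSEQ A)
  then have "(\<lambda>N. 2 * suminf A * tail N) \<longlonglongrightarrow> 0" by simp
  ultimately have "(\<lambda>N. roots_mean N f z - (\<Sum>k<N. (norm (a k))\<^sup>2 * ((norm z)\<^sup>2) ^ k)) \<longlonglongrightarrow> 0"
    by (rule Lim_null_comparison)
  from tendsto_add[OF this summable_LIMSEQ[OF M]] show ?thesis by simp
qed

text \<open>By rotation invariance each of the \<open>N\<close> rotated copies has the same
  integral, and so does their average.\<close>

lemma nn_integral_roots_mean:
  assumes [measurable]: "g \<in> borel_measurable borel" and N: "N > 0"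
  shows "(\<integral>\<^sup>+ z. ennreal (roots_mean N g z) \<partial>weighted_disc_area \<alpha>) = bergman_sqnorm \<alpha> g"
proof -
  define c where "c j = cis (2 * pi * real j / real N)" for j
  have [measurable]: "(\<lambda>z. ennreal ((norm (g z))\<^sup>2)) \<in> borel_measurable borel"
    by measurable
  have "(\<integral>\<^sup>+ z. ennreal (roots_mean N g z) \<partial>weighted_disc_area \<alpha>)
    = (\<integral>\<^sup>+ z. ennreal (1 / real N) * (\<Sum>j<N. ennreal ((norm (g (c j * z)))\<^sup>2)) \<partial>weighted_disc_area \<alpha>)"
    by (intro nn_integral_cong)
      (simp add: roots_mean_def c_def sum_nonneg ennreal_mult'[symmetric])
  also have "\<dots> = ennreal (1 / real N) * (\<Sum>j<N. \<integral>\<^sup>+ z. ennreal ((norm (g (c j * z)))\<^sup>2) \<partial>weighted_disc_area \<alpha>)"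
    by (subst nn_integral_cmult, measurable, subst nn_integral_sum, measurable)
  also have "\<dots> = ennreal (1 / real N) * (\<Sum>j<N. bergman_sqnorm \<alpha> g)"
    using nn_integral_weighted_disc_area_rotate[of "c _" "\<lambda>z. ennreal ((norm (g z))\<^sup>2)" \<alpha>]
    by (simp add: bergman_sqnorm_def c_def)
  also have "\<dots> = bergman_sqnorm \<alpha> g"
    using N by (simp add: ennreal_of_nat_eq_real_of_nat mult.assoc[symmetric] flip: ennreal_mult')
  finally show ?thesis .
qed

section \<open>The norm formula\<close>

theorem bergman_sqnorm_eq_nn_integral_powser:
  fixes a :: "nat \<Rightarrow> complex"
  assumes sums: "\<And>z. z \<in> unit_disc \<Longrightarrow> (\<lambda>k. a k * z ^ k) sums f z"
  shows "bergman_sqnorm \<alpha> f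
    = (\<integral>\<^sup>+ z. ennreal (\<Sum>k. (norm (a k))\<^sup>2 * ((norm z)\<^sup>2) ^ k) \<partial>weighted_disc_area \<alpha>)"
    (is "_ = ?I")
proof (rule antisym)
  \<comment> \<open>Cutting off by zero outside the disc yields a Borel function on the plane with
    the same norm as \<open>f\<close>.\<close>
  define g where "g z = indicator unit_disc z *\<^sub>R f z" for z
  define p where "p n z = (\<Sum>k<n. a k * z ^ k)" for n z
  have "f holomorphic_on unit_disc"
    by (rule power_series_holomorphic[where a = a]) (use sums in simp)
  then have [measurable]: "g \<in> borel_measurable borel"
    unfolding g_def
    by (intro borel_measurable_continuous_on_indicator holomorphic_on_imp_continuous_on) auto
  have [measurable]: "p n \<in> borel_measurable borel" for n
    unfolding p_def by measurable
  have fg: "bergman_sqnorm \<alpha> f = bergman_sqnorm \<alpha> g"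
    by (rule bergman_sqnorm_cong) (simp add: g_def)
  have gsums: "(\<lambda>k. a k * z ^ k) sums g z" if "z \<in> unit_disc" for z
    using sums[OF that] that by (simp add: g_def)
  have [measurable]: "roots_mean N g \<in> borel_measurable borel" for N
    unfolding roots_mean_def by measurable

  \<comment> \<open>First use of Fatou: all the means of \<open>g\<close> have the same integral.
    The shift to \<open>Suc N\<close> keeps the number of roots positive.\<close>
  have "?I = (\<integral>\<^sup>+ z. liminf (\<lambda>N. ennreal (roots_mean (Suc N) g z)) \<partial>weighted_disc_area \<alpha>)"
  proof (rule nn_integral_cong_AE, rule AE_mp[OF AE_weighted_disc_area], rule AE_I2, rule impI)
    fix z :: complex assume "z \<in> unit_disc"
    from LIMSEQ_Suc[OF roots_mean_tendsto[OF gsums this]]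
    have "(\<lambda>N. ennreal (roots_mean (Suc N) g z)) \<longlonglongrightarrow> ennreal (\<Sum>k. (norm (a k))\<^sup>2 * ((norm z)\<^sup>2) ^ k)"
      by (rule tendsto_ennrealI)
    then show "ennreal (\<Sum>k. (norm (a k))\<^sup>2 * ((norm z)\<^sup>2) ^ k) = liminf (\<lambda>N. ennreal (roots_mean (Suc N) g z))"
      by (intro lim_imp_Liminf[symmetric]) auto
  qed
  also have "\<dots> \<le> liminf (\<lambda>N. \<integral>\<^sup>+ z. ennreal (roots_mean (Suc N) g z) \<partial>weighted_disc_area \<alpha>)"
    by (rule nn_integral_liminf) measurable
  also have "\<dots> = bergman_sqnorm \<alpha> f"
    by (simp add: nn_integral_roots_mean fg Liminf_const)
  finally show "?I \<le> bergman_sqnorm \<alpha> f" .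

  have p: "bergman_sqnorm \<alpha> (p n) \<le> ?I" for n
  proof -
    \<comment> \<open>With \<open>Suc n\<close> roots the mean of \<open>p n\<close> is exact, and
      the number of roots is positive even for \<open>n = 0\<close>.\<close>
    have "bergman_sqnorm \<alpha> (p n) = (\<integral>\<^sup>+ z. ennreal (roots_mean (Suc n) (p n) z) \<partial>weighted_disc_area \<alpha>)"
      by (rule nn_integral_roots_mean[symmetric]) auto
    also have "\<dots> = (\<integral>\<^sup>+ z. ennreal (\<Sum>k<n. (norm (a k))\<^sup>2 * ((norm z)\<^sup>2) ^ k) \<partial>weighted_disc_area \<alpha>)"
      by (simp add: p_def[abs_def] roots_mean_polynomial)
    also have "\<dots> \<le> ?I"
      by (rule nn_integral_mono_AE, rule AE_mp[OF AE_weighted_disc_area AE_I2], rule impI,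
          intro ennreal_leI sum_le_suminf summable_norm_coeff_sq_power[OF sums])
        (simp_all add: abs_square_less_1)
    finally show ?thesis .
  qed
  \<comment> \<open>Second use of Fatou, along the partial sums, whose norms are all bounded by the
    same integral.\<close>
  have "bergman_sqnorm \<alpha> f = (\<integral>\<^sup>+ z. liminf (\<lambda>n. ennreal ((norm (p n z))\<^sup>2)) \<partial>weighted_disc_area \<alpha>)"
    unfolding bergman_sqnorm_def
  proof (rule nn_integral_cong_AE, rule AE_mp[OF AE_weighted_disc_area], rule AE_I2, rule impI)
    fix z :: complex assume "z \<in> unit_disc"
    then have "(\<lambda>n. p n z) \<longlonglongrightarrow> f z"
      using sums unfolding p_def sums_def by simp
    then have "(\<lambda>n. ennreal ((norm (p n z))\<^sup>2)) \<longlonglongrightarrow> ennreal ((norm (f z))\<^sup>2)"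
      by (intro tendsto_ennrealI tendsto_intros)
    then show "ennreal ((norm (f z))\<^sup>2) = liminf (\<lambda>n. ennreal ((norm (p n z))\<^sup>2))"
      by (intro lim_imp_Liminf[symmetric]) auto
  qed
  also have "\<dots> \<le> liminf (\<lambda>n. bergman_sqnorm \<alpha> (p n))"
    unfolding bergman_sqnorm_def by (rule nn_integral_liminf) measurable
  also have "\<dots> \<le> liminf (\<lambda>n :: nat. ?I)"
    by (intro Liminf_mono always_eventually allI p)
  finally show "bergman_sqnorm \<alpha> f \<le> ?I"
    by (simp add: Liminf_const)
qed

text \<open>All terms are nonnegative, so sum and integral can be exchanged: the norm is a weighted
  l2 norm of the coefficients, with the moments of the measure as weights.\<close>

corollary bergman_sqnorm_eq_suminf:
  fixes a :: "nat \<Rightarrow> complex"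
  assumes sums: "\<And>z. z \<in> unit_disc \<Longrightarrow> (\<lambda>k. a k * z ^ k) sums f z"
  shows "bergman_sqnorm \<alpha> f
    = (\<Sum>k. ennreal ((norm (a k))\<^sup>2) * (\<integral>\<^sup>+ z. ennreal (((norm z)\<^sup>2) ^ k) \<partial>weighted_disc_area \<alpha>))"
proof -
  have "bergman_sqnorm \<alpha> f
    = (\<integral>\<^sup>+ z. ennreal (\<Sum>k. (norm (a k))\<^sup>2 * ((norm z)\<^sup>2) ^ k) \<partial>weighted_disc_area \<alpha>)"
    by (rule bergman_sqnorm_eq_nn_integral_powser) (rule sums)
  also have "\<dots> = (\<integral>\<^sup>+ z. (\<Sum>k. ennreal ((norm (a k))\<^sup>2) * ennreal (((norm z)\<^sup>2) ^ k)) \<partial>weighted_disc_area \<alpha>)"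
  proof (rule nn_integral_cong_AE, rule AE_mp[OF AE_weighted_disc_area], rule AE_I2, rule impI)
    fix z :: complex assume "z \<in> unit_disc"
    then have "summable (\<lambda>k. (norm (a k))\<^sup>2 * ((norm z)\<^sup>2) ^ k)"
      by (intro summable_norm_coeff_sq_power[OF sums]) (auto simp: abs_square_less_1)
    then show "ennreal (\<Sum>k. (norm (a k))\<^sup>2 * ((norm z)\<^sup>2) ^ k)
      = (\<Sum>k. ennreal ((norm (a k))\<^sup>2) * ennreal (((norm z)\<^sup>2) ^ k))"
      by (subst suminf_ennreal2[symmetric]) (auto simp: ennreal_mult)
  qed
  also have "\<dots> = (\<Sum>k. \<integral>\<^sup>+ z. ennreal ((norm (a k))\<^sup>2) * ennreal (((norm z)\<^sup>2) ^ k) \<partial>weighted_disc_area \<alpha>)"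
    by (rule nn_integral_suminf) measurable
  also have "\<dots> = (\<Sum>k. ennreal ((norm (a k))\<^sup>2) * (\<integral>\<^sup>+ z. ennreal (((norm z)\<^sup>2) ^ k) \<partial>weighted_disc_area \<alpha>))"
    by (intro suminf_cong nn_integral_cmult) measurable
  finally show ?thesis .
qed

section \<open>Inclusions, density and separating examples\<close>

lemma powser_in_disc_holomorphic:
  assumes "f \<in> extensional unit_disc" "\<And>z. z \<in> unit_disc \<Longrightarrow> (\<lambda>k. a k * z ^ k) sums f z"
  shows "f \<in> disc_holomorphic"
  using assms power_series_holomorphic[of 0 1 a f] by (simp add: disc_holomorphic_def)

lemma disc_holomorphic_powser:
  assumes "f \<in> disc_holomorphic"
  obtains a where "\<And>z. z \<in> unit_disc \<Longrightarrow> (\<lambda>k. a k * z ^ k) sums f z"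
proof
  fix z assume "z \<in> unit_disc"
  with assms show "(\<lambda>k. (deriv ^^ k) f 0 / fact k * z ^ k) sums f z"
    using holomorphic_power_series[of f 0 1 z] by (simp add: disc_holomorphic_def)
qed

section \<open>Inclusions\<close>

text \<open>On the disc \<open>1 - (norm z)\<^sup>2\<close> lies in (0,1], so raising the exponent
  lowers the power; only the ratio of the normalising constants remains as a factor.\<close>

lemma bergman_mono:
  assumes "-1 < \<alpha>" "\<alpha> \<le> \<beta>"
  shows "bergman \<alpha> \<subseteq> bergman \<beta>"
proof
  fix f assume f: "f \<in> bergman \<alpha>"
  then have hol: "f \<in> disc_holomorphic" and fin: "bergman_sqnorm \<alpha> f < \<infinity>"
    by (simp_all add: bergman_def)
  from hol obtain a where a: "\<And>z. z \<in> unit_disc \<Longrightarrow> (\<lambda>k. a k * z ^ k) sums f z"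
    by (rule disc_holomorphic_powser) blast
  \<comment> \<open>This radial function is Borel on the whole plane and stands in for the squared
    modulus of \<open>f\<close>, so the weights can be compared as densities.\<close>
  define G where "G z = ennreal (\<Sum>k. (norm (a k))\<^sup>2 * ((norm z)\<^sup>2) ^ k)" for z :: complex
  have [measurable]: "G \<in> borel_measurable borel"
    unfolding G_def by measurable
  have sq: "bergman_sqnorm \<gamma> f
      = (\<integral>\<^sup>+ z. ennreal ((1 + \<gamma>) * (1 - (norm z)\<^sup>2) powr \<gamma>) * G z \<partial>disc_area)" for \<gamma>
    using bergman_sqnorm_eq_nn_integral_powser[where a = a and f = f and \<alpha> = \<gamma>] a
      nn_integral_weighted_disc_area[of G \<gamma>] by (simp add: G_def)
  have "bergman_sqnorm \<beta> f \<le> (\<integral>\<^sup>+ z. ennreal ((1 + \<beta>) / (1 + \<alpha>)) *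
      (ennreal ((1 + \<alpha>) * (1 - (norm z)\<^sup>2) powr \<alpha>) * G z) \<partial>disc_area)"
    unfolding sq
  proof (rule nn_integral_mono_AE, rule AE_mp[OF AE_disc_area AE_I2], rule impI)
    fix z :: complex assume "z \<in> unit_disc"
    then have "(norm z)\<^sup>2 < 1" by (simp add: abs_square_less_1)
    then have "(1 - (norm z)\<^sup>2) powr \<beta> \<le> (1 - (norm z)\<^sup>2) powr \<alpha>"
      using assms by (intro powr_mono') auto
    then have "(1 + \<beta>) * (1 - (norm z)\<^sup>2) powr \<beta>
        \<le> (1 + \<beta>) / (1 + \<alpha>) * ((1 + \<alpha>) * (1 - (norm z)\<^sup>2) powr \<alpha>)"
      using assms by simp
    then have "ennreal ((1 + \<beta>) * (1 - (norm z)\<^sup>2) powr \<beta>)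
        \<le> ennreal ((1 + \<beta>) / (1 + \<alpha>)) * ennreal ((1 + \<alpha>) * (1 - (norm z)\<^sup>2) powr \<alpha>)"
      using assms by (subst ennreal_mult[symmetric]) (auto intro: ennreal_leI)
    then show "ennreal ((1 + \<beta>) * (1 - (norm z)\<^sup>2) powr \<beta>) * G z
        \<le> ennreal ((1 + \<beta>) / (1 + \<alpha>)) * (ennreal ((1 + \<alpha>) * (1 - (norm z)\<^sup>2) powr \<alpha>) * G z)"
      unfolding mult.assoc[symmetric] by (rule mult_right_mono) simp
  qed
  also have "\<dots> = ennreal ((1 + \<beta>) / (1 + \<alpha>)) * bergman_sqnorm \<alpha> f"
    unfolding sq by (rule nn_integral_cmult) measurable
  also have "\<dots> < \<infinity>"
    using fin by (simp add: ennreal_mult_less_top)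
  finally show "f \<in> bergman \<beta>"
    using hol by (simp add: bergman_def)
qed

lemma suminf_mult_power_le:
  fixes A :: "nat \<Rightarrow> real"
  assumes A: "summable A" "\<And>k. 0 \<le> A k" and t: "0 \<le> t" "t \<le> 1"
  shows "(\<Sum>k. A k * t ^ k) \<le> suminf A"
proof (rule suminf_le)
  show le: "A k * t ^ k \<le> A k" for k
    by (rule mult_left_le) (simp_all add: A t power_le_one)
  show "summable (\<lambda>k. A k * t ^ k)"
    by (rule summable_comparison_test'[OF A(1), of 0]) (use le A t in simp)
qed (rule A)

text \<open>The squared Hardy norm bounds the radial integrand pointwise on the disc, and the
  measure has total mass 1.\<close>

lemma hardy2_subset_bergman:
  assumes "-1 < \<alpha>"
  shows "hardy2 \<subseteq> bergman \<alpha>"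
proof
  fix f assume "f \<in> hardy2"
  then obtain a where hol: "f \<in> disc_holomorphic"
    and a: "\<And>z. z \<in> unit_disc \<Longrightarrow> (\<lambda>k. a k * z ^ k) sums f z"
    and S: "summable (\<lambda>k. (norm (a k))\<^sup>2)"
    unfolding hardy2_def by blast
  have "bergman_sqnorm \<alpha> f
      = (\<integral>\<^sup>+ z. ennreal (\<Sum>k. (norm (a k))\<^sup>2 * ((norm z)\<^sup>2) ^ k) \<partial>weighted_disc_area \<alpha>)"
    by (rule bergman_sqnorm_eq_nn_integral_powser) (rule a)
  also have "\<dots> \<le> (\<integral>\<^sup>+ z. ennreal (\<Sum>k. (norm (a k))\<^sup>2) \<partial>weighted_disc_area \<alpha>)"
  proof (rule nn_integral_mono_AE, rule AE_mp[OF AE_weighted_disc_area AE_I2], rule impI)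
    fix z :: complex assume "z \<in> unit_disc"
    then have z: "(norm z)\<^sup>2 < 1" by (simp add: abs_square_less_1)
    then show "ennreal (\<Sum>k. (norm (a k))\<^sup>2 * ((norm z)\<^sup>2) ^ k) \<le> ennreal (\<Sum>k. (norm (a k))\<^sup>2)"
      by (intro ennreal_leI suminf_mult_power_le S) (simp_all only: zero_le_power2 less_imp_le)
  qed
  also have "\<dots> = ennreal (\<Sum>k. (norm (a k))\<^sup>2)"
    by (simp add: emeasure_weighted_disc_area_UNIV assms)
  also have "\<dots> < \<infinity>" by simp
  finally show "f \<in> bergman \<alpha>"
    using hol by (simp add: bergman_def)
qed

lemma disc_polynomials_subset_hardy2: "disc_polynomials \<subseteq> hardy2"
proof
  fix f assume "f \<in> disc_polynomials"
  then obtain p :: "complex poly" where f: "f = restrict (poly p) unit_disc"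
    by (auto simp: disc_polynomials_def)
  have sums: "(\<lambda>k. coeff p k * z ^ k) sums f z" if "z \<in> unit_disc" for z
  proof -
    have "(\<lambda>k. coeff p k * z ^ k) sums (\<Sum>k\<le>degree p. coeff p k * z ^ k)"
      by (rule sums_finite) (auto intro: coeff_eq_0)
    with that show ?thesis by (simp add: f poly_altdef)
  qed
  moreover have "summable (\<lambda>k. (norm (coeff p k))\<^sup>2)"
    by (rule summable_finite[of "{..degree p}"]) (auto intro: coeff_eq_0)
  moreover have "f \<in> disc_holomorphic"
    by (rule powser_in_disc_holomorphic[OF _ sums]) (simp only: f restrict_extensional)
  ultimately show "f \<in> hardy2"
    unfolding hardy2_def by blast
qed

section \<open>Density\<close>

text \<open>Taylor polynomials approximate: by \<open>bergman_sqnorm_eq_suminf\<close> the squared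
  error is a tail of the convergent series for the squared norm of \<open>f\<close>.\<close>

lemma disc_polynomials_dense:
  assumes "-1 < \<beta>"
  shows "dense_in_bergman \<beta> disc_polynomials"
  unfolding dense_in_bergman_def
proof (intro conjI ballI allI impI)
  show "disc_polynomials \<subseteq> bergman \<beta>"
    using disc_polynomials_subset_hardy2 hardy2_subset_bergman[OF assms] by blast
  fix f \<epsilon> assume f: "f \<in> bergman \<beta>" and \<epsilon>: "(0::real) < \<epsilon>"
  then have hol: "f \<in> disc_holomorphic" and fin: "bergman_sqnorm \<beta> f < \<infinity>"
    by (simp_all add: bergman_def)
  from hol obtain a where a: "\<And>z. z \<in> unit_disc \<Longrightarrow> (\<lambda>k. a k * z ^ k) sums f z"
    by (rule disc_holomorphic_powser) blast
  define y where "y k = ennreal ((norm (a k))\<^sup>2)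
      * (\<integral>\<^sup>+ z. ennreal (((norm z)\<^sup>2) ^ k) \<partial>weighted_disc_area \<beta>)" for k
  \<comment> \<open>Every \<open>y k\<close> is finite, being bounded by a finite sum, so the series
    may be treated as a real one whose tails tend to 0.\<close>
  define x where "x k = enn2real (y k)" for k
  have sum_y: "bergman_sqnorm \<beta> f = suminf y"
    unfolding y_def by (rule bergman_sqnorm_eq_suminf) (rule a)
  have "y k \<le> suminf y" for k
    using sum_le_suminf[of y "{k}"] by simp
  with fin sum_y have "y k < \<infinity>" for k
    by (metis order_le_less_trans)
  then have yx: "y k = ennreal (x k)" for k
    by (simp add: x_def)
  have x0: "0 \<le> x k" for k by (simp add: x_def)
  have x: "summable x"
    by (rule summable_suminf_not_top) (use x0 fin sum_y in \<open>auto simp flip: yx\<close>)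
  have "(\<lambda>N. suminf x - (\<Sum>k<N. x k)) \<longlonglongrightarrow> suminf x - suminf x"
    by (intro tendsto_diff tendsto_const summable_LIMSEQ x)
  then have "\<forall>\<^sub>F N in sequentially. suminf x - (\<Sum>k<N. x k) < \<epsilon>\<^sup>2"
    using \<epsilon> by (intro order_tendstoD(2)) auto
  then obtain N where N: "suminf x - (\<Sum>k<N. x k) < \<epsilon>\<^sup>2"
    by (auto simp: eventually_sequentially)
  define p where "p = (\<Sum>k<N. monom (a k) k)"
  define g where "g = restrict (poly p) unit_disc"
  \<comment> \<open>The Taylor coefficients of the error \<open>f - g\<close> on the disc.\<close>
  define b where "b k = (if k < N then 0 else a k)" for k
  have "(\<lambda>k. b k * z ^ k) sums (f z - g z)" if "z \<in> unit_disc" for z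
  proof -
    have "(\<lambda>k. a k * z ^ k - (if k \<in> {..<N} then a k * z ^ k else 0)) sums (f z - (\<Sum>k<N. a k * z ^ k))"
      by (intro sums_diff a that sums_If_finite_set) simp
    moreover have "g z = (\<Sum>k<N. a k * z ^ k)"
      using that by (simp add: g_def p_def poly_sum poly_monom)
    moreover have "a k * z ^ k - (if k \<in> {..<N} then a k * z ^ k else 0) = b k * z ^ k" for k
      by (simp add: b_def)
    ultimately show ?thesis by simp
  qed
  then have "bergman_sqnorm \<beta> (\<lambda>z. f z - g z) = (\<Sum>k. ennreal ((norm (b k))\<^sup>2)
      * (\<integral>\<^sup>+ z. ennreal (((norm z)\<^sup>2) ^ k) \<partial>weighted_disc_area \<beta>))"
    by (rule bergman_sqnorm_eq_suminf)
  also have "\<dots> = (\<Sum>k. ennreal (if k < N then 0 else x k))"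
    by (intro suminf_cong) (simp add: b_def flip: yx, simp add: y_def)
  also have "\<dots> = ennreal (suminf x - (\<Sum>k<N. x k))"
  proof (rule suminf_ennreal_eq)
    have "(\<lambda>k. x k - (if k \<in> {..<N} then x k else 0)) sums (suminf x - (\<Sum>k<N. x k))"
      by (intro sums_diff summable_sums x sums_If_finite_set) simp
    moreover have "x k - (if k \<in> {..<N} then x k else 0) = (if k < N then 0 else x k)" for k
      by simp
    ultimately show "(\<lambda>k. if k < N then 0 else x k) sums (suminf x - (\<Sum>k<N. x k))"
      by simp
  qed (simp add: x0)
  finally have "bergman_norm \<beta> (\<lambda>z. f z - g z) = sqrt (suminf x - (\<Sum>k<N. x k))"
    \<comment> \<open>The tail is nonnegative, so converting it to \<open>ennreal\<close> and back
      leaves it unchanged.\<close>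
    using sum_le_suminf[OF x, of "{..<N}"] x0 by (simp add: bergman_norm_def)
  also have "\<dots> < \<epsilon>"
    using N \<epsilon> by (intro real_less_lsqrt) auto
  finally show "\<exists>g\<in>disc_polynomials. bergman_norm \<beta> (\<lambda>z. f z - g z) < \<epsilon>"
    by (intro bexI[of _ g]) (simp_all add: g_def disc_polynomials_def)
qed

lemma dense_in_bergman_superset:
  assumes "dense_in_bergman \<beta> S" "S \<subseteq> T" "T \<subseteq> bergman \<beta>"
  shows "dense_in_bergman \<beta> T"
  using assms unfolding dense_in_bergman_def by blast

section \<open>Separating examples\<close>

text \<open>Any power series \<open>M\<close> with nonnegative coefficients that converges on [0,1)
  can be prescribed: square roots of its coefficients serve as Taylor coefficients.\<close>

lemma disc_holomorphic_with_coeff_norms: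
  fixes c :: "nat \<Rightarrow> real"
  assumes c0: "\<And>k. 0 \<le> c k"
    and c: "\<And>t. 0 \<le> t \<Longrightarrow> t < 1 \<Longrightarrow> (\<lambda>k. c k * t ^ k) sums M t"
  obtains f where "f \<in> disc_holomorphic"
    "\<And>z. z \<in> unit_disc \<Longrightarrow> (\<lambda>k. complex_of_real (sqrt (c k)) * z ^ k) sums f z"
    "\<And>\<alpha>. bergman_sqnorm \<alpha> f = (\<integral>\<^sup>+ z. ennreal (M ((norm z)\<^sup>2)) \<partial>weighted_disc_area \<alpha>)"
proof
  define f where "f = restrict (\<lambda>z. \<Sum>k. complex_of_real (sqrt (c k)) * z ^ k) unit_disc"
  show sums: "(\<lambda>k. complex_of_real (sqrt (c k)) * z ^ k) sums f z" if z: "z \<in> unit_disc" for z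
  proof -
    let ?r = "norm z"
    have bound: "norm (norm (complex_of_real (sqrt (c k)) * z ^ k)) \<le> (c k * ?r ^ k + ?r ^ k) / 2" for k
    proof -
      have "0 \<le> (sqrt (c k) - 1)\<^sup>2" by simp
      then have "sqrt (c k) \<le> (c k + 1) / 2"
        using c0[of k] by (simp add: power2_diff)
      from mult_right_mono[OF this, of "?r ^ k"] show ?thesis
        using c0[of k] by (simp add: norm_mult norm_power add_divide_distrib distrib_right)
    qed
    have "summable (\<lambda>k. c k * ?r ^ k)"
      by (rule sums_summable[OF c]) (use z in simp_all)
    moreover have "summable (\<lambda>k. ?r ^ k)"
      by (rule summable_geometric) (use z in simp)
    ultimately have "summable (\<lambda>k. (c k * ?r ^ k + ?r ^ k) / 2)"
      by (intro summable_divide summable_add)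
    then have "summable (\<lambda>k. norm (complex_of_real (sqrt (c k)) * z ^ k))"
      by (rule summable_comparison_test'[where N = 0]) (rule bound)
    then have "summable (\<lambda>k. complex_of_real (sqrt (c k)) * z ^ k)"
      by (rule summable_norm_cancel)
    with z show ?thesis by (simp add: f_def summable_sums)
  qed
  show "f \<in> disc_holomorphic"
    by (rule powser_in_disc_holomorphic[OF _ sums]) (simp only: f_def restrict_extensional)
  show "bergman_sqnorm \<alpha> f = (\<integral>\<^sup>+ z. ennreal (M ((norm z)\<^sup>2)) \<partial>weighted_disc_area \<alpha>)" for \<alpha>
  proof -
    have "bergman_sqnorm \<alpha> f = (\<integral>\<^sup>+ z. ennreal (\<Sum>k. (norm (complex_of_real (sqrt (c k))))\<^sup>2
        * ((norm z)\<^sup>2) ^ k) \<partial>weighted_disc_area \<alpha>)"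
      by (rule bergman_sqnorm_eq_nn_integral_powser) (rule sums)
    also have "\<dots> = (\<integral>\<^sup>+ z. ennreal (M ((norm z)\<^sup>2)) \<partial>weighted_disc_area \<alpha>)"
    proof (rule nn_integral_cong_AE, rule AE_mp[OF AE_weighted_disc_area AE_I2], rule impI)
      fix z :: complex assume "z \<in> unit_disc"
      then have "(\<lambda>k. c k * ((norm z)\<^sup>2) ^ k) sums M ((norm z)\<^sup>2)"
        by (intro c) (simp_all add: abs_square_less_1)
      then show "ennreal (\<Sum>k. (norm (complex_of_real (sqrt (c k))))\<^sup>2 * ((norm z)\<^sup>2) ^ k)
          = ennreal (M ((norm z)\<^sup>2))"
        using c0 by (simp add: sums_iff)
    qed
    finally show ?thesis .
  qed
qed

lemma bergman_critical_example:
  assumes "-1 < \<alpha>"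
  obtains f where "f \<notin> bergman \<alpha>" "\<And>\<beta>. \<alpha> < \<beta> \<Longrightarrow> f \<in> bergman \<beta>"
proof -
  define s where "s = 1 + \<alpha>"
  have s: "s > 0" using assms by (simp add: s_def)
  define c where "c k = pochhammer s k / fact k" for k
  have c0: "0 \<le> c k" for k
    using s by (simp add: c_def pochhammer_nonneg)
  have c: "(\<lambda>k. c k * t ^ k) sums ((1 - t) powr (- s))" if "0 \<le> t" "t < 1" for t
  proof -
    have "(- s gchoose k) * (- t) ^ k = c k * t ^ k" for k
      by (cases "even k") (simp_all add: c_def gbinomial_pochhammer)
    then show ?thesis
      using gen_binomial_real[of "- t" "- s"] that by simp
  qed
  obtain f where f: "f \<in> disc_holomorphic"
    and "\<And>z. z \<in> unit_disc \<Longrightarrow> (\<lambda>k. complex_of_real (sqrt (c k)) * z ^ k) sums f z"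
    and sq: "\<And>\<beta>. bergman_sqnorm \<beta> f
      = (\<integral>\<^sup>+ z. ennreal ((1 - (norm z)\<^sup>2) powr (- s)) \<partial>weighted_disc_area \<beta>)"
    by (rule disc_holomorphic_with_coeff_norms[of c "\<lambda>t. (1 - t) powr (- s)", OF c0])
      (rule c, assumption, assumption, rule that)
  show thesis
  proof
    have "bergman_sqnorm \<alpha> f = ennreal (1 + \<alpha>) * \<infinity>"
      using nn_integral_inverse_unit_interval
      by (simp add: sq nn_integral_weighted_disc_area_powr s_def)
    then have "bergman_sqnorm \<alpha> f = \<infinity>"
      using s by (simp add: s_def ennreal_mult_top)
    then show "f \<notin> bergman \<alpha>" by (simp add: bergman_def)
    show "f \<in> bergman \<beta>" if "\<alpha> < \<beta>" for \<beta>
    proof -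
      have "bergman_sqnorm \<beta> f = ennreal (1 + \<beta>) * ennreal (1 / (\<beta> + - s + 1))"
        unfolding sq nn_integral_weighted_disc_area_powr
        using that by (subst nn_integral_powr_unit_interval) (simp_all add: s_def)
      also have "\<dots> < \<infinity>" by (simp add: ennreal_mult_less_top)
      finally show ?thesis
        using f by (simp add: bergman_def)
    qed
  qed
qed

lemma bergman_not_hardy2_example:
  obtains f where "f \<notin> hardy2" "\<And>\<beta>. -1 < \<beta> \<Longrightarrow> f \<in> bergman \<beta>"
proof -
  \<comment> \<open>The coefficient at \<open>k = 0\<close> is \<open>1 / 0 = 0\<close>.\<close>
  define c where "c k = 1 / real k" for k
  have c0: "0 \<le> c k" for k by (simp add: c_def)
  have c: "(\<lambda>k. c k * t ^ k) sums (- ln (1 - t))" if "0 \<le> t" "t < 1" for t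
    using sums_minus[OF ln_series'[of "- t"]] that by (simp add: c_def)
  obtain f where f: "f \<in> disc_holomorphic"
    and sums: "\<And>z. z \<in> unit_disc \<Longrightarrow> (\<lambda>k. complex_of_real (sqrt (c k)) * z ^ k) sums f z"
    and sq: "\<And>\<beta>. bergman_sqnorm \<beta> f
      = (\<integral>\<^sup>+ z. ennreal (- ln (1 - (norm z)\<^sup>2)) \<partial>weighted_disc_area \<beta>)"
    by (rule disc_holomorphic_with_coeff_norms[of c "\<lambda>t. - ln (1 - t)", OF c0])
      (rule c, assumption, assumption, rule that)
  show thesis
  proof
    show "f \<in> bergman \<beta>" if "-1 < \<beta>" for \<beta>
    proof -
      define e where "e = (1 + \<beta>) / 2"
      have e: "e > 0" using that by (simp add: e_def)
      have "bergman_sqnorm \<beta> f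
        \<le> (\<integral>\<^sup>+ z. ennreal (1 / e) * ennreal ((1 - (norm z)\<^sup>2) powr (- e)) \<partial>weighted_disc_area \<beta>)"
        unfolding sq
      proof (rule nn_integral_mono_AE, rule AE_mp[OF AE_weighted_disc_area AE_I2], rule impI)
        fix z :: complex assume "z \<in> unit_disc"
        then have z: "(norm z)\<^sup>2 < 1" by (simp add: abs_square_less_1)
        define u where "u = 1 - (norm z)\<^sup>2"
        have u: "0 < u" "u \<le> 1" using z by (simp_all add: u_def)
        have "- ln u = ln (1 / u)" using u by (simp add: ln_div)
        also have "\<dots> \<le> (1 / u) powr e / e" using u e by (intro ln_powr_bound) auto
        also have "\<dots> = 1 / e * u powr (- e)" using u by (simp add: powr_minus_divide powr_divide)
        finally show "ennreal (- ln (1 - (norm z)\<^sup>2))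
            \<le> ennreal (1 / e) * ennreal ((1 - (norm z)\<^sup>2) powr (- e))"
          using e by (subst ennreal_mult[symmetric]) (auto simp: u_def intro: ennreal_leI)
      qed
      also have "\<dots> = ennreal (1 / e) *
          (\<integral>\<^sup>+ z. ennreal ((1 - (norm z)\<^sup>2) powr (- e)) \<partial>weighted_disc_area \<beta>)"
        by (rule nn_integral_cmult) measurable
      also have "\<dots> = ennreal (1 / e) * (ennreal (1 + \<beta>) * ennreal (1 / (\<beta> + - e + 1)))"
        unfolding nn_integral_weighted_disc_area_powr
        using that by (subst nn_integral_powr_unit_interval) (simp_all add: e_def field_simps)
      also have "\<dots> < \<infinity>" by (simp add: ennreal_mult_less_top)
      finally show ?thesis using f by (simp add: bergman_def)
    qed
    show "f \<notin> hardy2"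
    proof
      assume "f \<in> hardy2"
      then obtain b where b: "\<And>z. z \<in> unit_disc \<Longrightarrow> (\<lambda>k. b k * z ^ k) sums f z"
        and S: "summable (\<lambda>k. (norm (b k))\<^sup>2)"
        unfolding hardy2_def by blast
      define t where "t = 1 - exp (- (\<Sum>k. (norm (b k))\<^sup>2) - 1)"
      have "0 \<le> (\<Sum>k. (norm (b k))\<^sup>2)" by (rule suminf_nonneg[OF S]) simp
      then have t: "0 \<le> t" "t < 1" by (simp_all add: t_def)
      define z where "z = complex_of_real (sqrt t)"
      have z: "z \<in> unit_disc" "(norm z)\<^sup>2 = t" using t by (simp_all add: z_def)
      have "(\<Sum>k. (norm (b k))\<^sup>2 * t ^ k) = (\<Sum>k. (norm (complex_of_real (sqrt (c k))))\<^sup>2 * t ^ k)"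
        using LIMSEQ_unique[OF roots_mean_tendsto[OF b z(1)] roots_mean_tendsto[OF sums z(1)]]
        by (simp only: z(2))
      also have "\<dots> = - ln (1 - t)"
        using c[OF t] c0 by (simp add: sums_iff)
      also have "\<dots> = (\<Sum>k. (norm (b k))\<^sup>2) + 1"
        by (simp add: t_def)
      finally have "(\<Sum>k. (norm (b k))\<^sup>2 * t ^ k) = (\<Sum>k. (norm (b k))\<^sup>2) + 1" .
      moreover have "(\<Sum>k. (norm (b k))\<^sup>2 * t ^ k) \<le> (\<Sum>k. (norm (b k))\<^sup>2)"
        using t by (intro suminf_mult_power_le S) simp_all
      ultimately show False by simp
    qed
  qed
qed

theorem theorem8p4:
  fixes \<alpha> :: real
  assumes "-1 < \<alpha>"
  shows "(\<forall>\<alpha>1 \<alpha>2. -1 < \<alpha>1 \<and> \<alpha>1 < \<alpha>2 \<longrightarrow> bergman \<alpha>1 \<subset> bergman \<alpha>2)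
    \<and> hardy2 \<subset> (\<Inter>\<gamma>\<in>{-1<..}. bergman \<gamma>)
    \<and> (\<Union>\<gamma>\<in>{-1<..<\<alpha>}. bergman \<gamma>) \<subseteq> bergman \<alpha>
    \<and> bergman \<alpha> \<subset> (\<Inter>\<beta>\<in>{\<alpha><..}. bergman \<beta>)
    \<and> (\<forall>\<beta>>\<alpha>. dense_in_bergman \<beta> disc_polynomials \<and> dense_in_bergman \<beta> hardy2
          \<and> dense_in_bergman \<beta> (bergman \<alpha>))"
proof (intro conjI allI impI)
  fix \<alpha>1 \<alpha>2 :: real assume *: "-1 < \<alpha>1 \<and> \<alpha>1 < \<alpha>2"
  then obtain f where "f \<notin> bergman \<alpha>1" "f \<in> bergman \<alpha>2"
    using bergman_critical_example[of \<alpha>1] by metis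
  with * bergman_mono[of \<alpha>1 \<alpha>2] show "bergman \<alpha>1 \<subset> bergman \<alpha>2" by auto
next
  obtain f where "f \<notin> hardy2" "\<And>\<beta>. -1 < \<beta> \<Longrightarrow> f \<in> bergman \<beta>"
    using bergman_not_hardy2_example by blast
  then show "hardy2 \<subset> (\<Inter>\<gamma>\<in>{-1<..}. bergman \<gamma>)"
    using hardy2_subset_bergman by auto
next
  show "(\<Union>\<gamma>\<in>{-1<..<\<alpha>}. bergman \<gamma>) \<subseteq> bergman \<alpha>"
    by (intro UN_least bergman_mono) auto
next
  obtain f where "f \<notin> bergman \<alpha>" "\<And>\<beta>. \<alpha> < \<beta> \<Longrightarrow> f \<in> bergman \<beta>"
    using bergman_critical_example[OF assms] by blast
  moreover have "bergman \<alpha> \<subseteq> (\<Inter>\<beta>\<in>{\<alpha><..}. bergman \<beta>)"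
    by (intro INT_greatest bergman_mono assms) auto
  ultimately show "bergman \<alpha> \<subset> (\<Inter>\<beta>\<in>{\<alpha><..}. bergman \<beta>)" by auto
next
  fix \<beta> assume "\<alpha> < \<beta>"
  with assms have \<beta>: "-1 < \<beta>" and "bergman \<alpha> \<subseteq> bergman \<beta>"
    using bergman_mono[OF assms, of \<beta>] by auto
  show P: "dense_in_bergman \<beta> disc_polynomials"
    by (rule disc_polynomials_dense[OF \<beta>])
  show H: "dense_in_bergman \<beta> hardy2"
    by (rule dense_in_bergman_superset[OF P disc_polynomials_subset_hardy2 hardy2_subset_bergman[OF \<beta>]])
  show "dense_in_bergman \<beta> (bergman \<alpha>)"
    by (rule dense_in_bergman_superset[OF H hardy2_subset_bergman[OF assms]]) fact
qed

end
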